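(* Let $r\geq 2$ and $n\geq m\geq 1$ be integers such that $n+m+2\geq \frac{(\lceil r/2\rceil+1)^2}{2}$. Then $$\widehat{R}_r(S_{n,m})\leq 4r^2nm+2r(n+m)+1.$$ Moreover, if $r=2$ then $\widehat{R}_r(S_{n,m})\geq \frac{1}{2}(m+1)(n+m+2)$, and if $r\geq 3$ then $\widehat{R}_r(S_{n,m})\geq \frac{r^2-1}{16}m(n+m+2)$.
   Context: Graphs are finite and simple. The $r$-color size-Ramsey number $\widehat{R}_r(H)$ of a graph $H$ is the minimum number of edges in a graph $G$ having the property that every $r$-coloring of the edges of $G$ contains a monochromatic copy of $H$ (as a not necessarily induced subgraph). The double star $S_{n,m}$ is the tree on $n+m+2$ vertices obtained from vertex-disjoint copies of $K_{1,n}$ and $K_{1,m}$ by joining their centers with an edge. *)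

theory Defs
  imports Complex_Main "HOL-Library.Ramsey"
begin

text \<open>
  A graph is a pair of a vertex set and a set of edges, an edge being a two-element set of vertices;
  \<^term>\<open>nsets V 2\<close> is the set of all two-element subsets of \<^term>\<open>V\<close>.
\<close>

type_synonym 'a ugraph = "'a set \<times> 'a set set"

abbreviation verts :: "'a ugraph \<Rightarrow> 'a set" where
  "verts \<equiv> fst"

abbreviation edges :: "'a ugraph \<Rightarrow> 'a set set" where
  "edges \<equiv> snd"

definition fin_simple_graph :: "'a ugraph \<Rightarrow> bool" where
  "fin_simple_graph G \<longleftrightarrow> finite (verts G) \<and> edges G \<subseteq> nsets (verts G) 2"

definition contains_copy :: "'a ugraph \<Rightarrow> 'b ugraph \<Rightarrow> bool" where
  "contains_copy G H \<longleftrightarrow>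
     (\<exists>f. inj_on f (verts H) \<and> f ` verts H \<subseteq> verts G \<and> (\<forall>e\<in>edges H. f ` e \<in> edges G))"

definition color_class :: "'a ugraph \<Rightarrow> ('a set \<Rightarrow> nat) \<Rightarrow> nat \<Rightarrow> 'a ugraph" where
  "color_class G c i = (verts G, {e \<in> edges G. c e = i})"

definition ramsey_graph :: "nat \<Rightarrow> 'a ugraph \<Rightarrow> 'b ugraph \<Rightarrow> bool" where
  "ramsey_graph r G H \<longleftrightarrow>
     (\<forall>c \<in> edges G \<rightarrow> {..<r}. \<exists>i<r. contains_copy (color_class G c i) H)"

text \<open>
  Every finite graph is isomorphic to one with vertices in \<^typ>\<open>nat\<close>, so restricting
  the host graphs to that type loses no generality. If no suitable host graph existed, the value of
  \<^const>\<open>Least\<close> would be unspecified (and not 0, as it would be with \<^const>\<open>Inf\<close>), so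
  no bound on it could be proved vacuously.
\<close>

definition size_ramsey :: "nat \<Rightarrow> 'b ugraph \<Rightarrow> nat" where
  "size_ramsey r H =
     (LEAST k. \<exists>G :: nat ugraph. fin_simple_graph G \<and> ramsey_graph r G H \<and> card (edges G) = k)"

text \<open>The star $K_{1,n}$ with centre 0 and leaves 1, ..., n.\<close>

definition star :: "nat \<Rightarrow> nat ugraph" where
  "star n = ({0..n}, (\<lambda>i. {0, i}) ` {1..n})"

definition double_star :: "nat \<Rightarrow> nat \<Rightarrow> (nat + nat) ugraph" where
  "double_star n m =
     (verts (star n) <+> verts (star m),
      (`) Inl ` edges (star n) \<union> (`) Inr ` edges (star m) \<union> {{Inl 0, Inr 0}})"

lemma fin_simple_graph_double_star: "fin_simple_graph (double_star n m)"
  by (auto simp: fin_simple_graph_def double_star_def star_def nsets_def card_insert_if)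

lemma card_verts_double_star: "card (verts (double_star n m)) = n + m + 2"
  by (simp add: double_star_def star_def card_Plus)

end

theory Submission
  imports Defs
begin

text \<open>
  Upper bound: in any colouring of the complete bipartite graph with parts of sizes \<open>2rn + 1\<close> and
  \<open>2rm + 1\<close>, the most frequent colour has an edge that survives the deletion of all vertices of
  too small colour degree.

  Lower bound: split \<open>r = s + t\<close> with \<open>s\<close> odd. A graph with few edges has few vertices of degree
  more than \<open>tm\<close>. Edges between two of those receive \<open>s\<close> colours, following a blown-up
  1-factorization of the complete graph on \<open>s + 1\<close> vertices, so that every colour component has
  fewer than \<open>n + m + 2\<close> vertices. The remaining edges receive \<open>t\<close> colours, as balanced as possible
  at the vertices of degree at most \<open>tm\<close>; then every edge has an end at which its colour occurs
  at most \<open>m\<close> times, so that no edge can be the central edge of a monochromatic double star.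
\<close>

section \<open>Copies of a double star: centres and leaf sets\<close>

lemma verts_double_star: "verts (double_star n m) = Inl ` {0..n} \<union> Inr ` {0..m}"
  by (simp add: double_star_def star_def Plus_def)

lemma edges_double_star:
  "edges (double_star n m) =
     (\<lambda>i. {Inl 0, Inl i}) ` {1..n} \<union> (\<lambda>i. {Inr 0, Inr i}) ` {1..m} \<union> {{Inl 0, Inr 0}}"
  by (simp add: double_star_def star_def image_image)

text \<open>Trades an embedding for its image: two adjacent centres with disjoint leaf sets. This
  direction serves the lower bound, which must exclude monochromatic copies; the converse
  \<open>contains_copy_double_starI\<close> serves the upper bound, which must build one.\<close>

lemma contains_copy_double_starE:
  assumes "contains_copy G (double_star n m)"
  obtains u v A B
  where "finite A" "finite B" "card A = n" "card B = m" "A \<inter> B = {}" "u \<noteq> v"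
    "u \<notin> A \<union> B" "v \<notin> A \<union> B" "{u, v} \<in> edges G"
    "\<And>a. a \<in> A \<Longrightarrow> {u, a} \<in> edges G" "\<And>b. b \<in> B \<Longrightarrow> {v, b} \<in> edges G"
proof -
  from assms obtain f where f: "inj_on f (verts (double_star n m))"
      "\<And>e. e \<in> edges (double_star n m) \<Longrightarrow> f ` e \<in> edges G"
    by (auto simp: contains_copy_def)
  define A where "A = (f \<circ> Inl) ` {1..n}"
  define B where "B = (f \<circ> Inr) ` {1..m}"
  have inj: "f x = f y \<longleftrightarrow> x = y"
    if "x \<in> verts (double_star n m)" "y \<in> verts (double_star n m)" for x y
    using f(1) that by (auto simp: inj_on_def)
  show ?thesis
  proof (rule that)
    show "card A = n" unfolding A_def
      by (subst card_image) (auto simp: inj_on_def inj verts_double_star)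
    show "card B = m" unfolding B_def
      by (subst card_image) (auto simp: inj_on_def inj verts_double_star)
    show "A \<inter> B = {}" "f (Inl 0) \<noteq> f (Inr 0)" "f (Inl 0) \<notin> A \<union> B" "f (Inr 0) \<notin> A \<union> B"
      unfolding A_def B_def by (auto simp: inj verts_double_star)
    show "{f (Inl 0), f (Inr 0)} \<in> edges G"
      using f(2)[of "{Inl 0, Inr 0}"] by (simp add: edges_double_star)
    have "{f (Inl 0), f (Inl i)} \<in> edges G" if "i \<in> {1..n}" for i
      using f(2)[of "{Inl 0, Inl i}"] that unfolding edges_double_star by auto
    then show "{f (Inl 0), a} \<in> edges G" if "a \<in> A" for a using that unfolding A_def by auto
    have "{f (Inr 0), f (Inr i)} \<in> edges G" if "i \<in> {1..m}" for i
      using f(2)[of "{Inr 0, Inr i}"] that unfolding edges_double_star by auto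
    then show "{f (Inr 0), b} \<in> edges G" if "b \<in> B" for b using that unfolding B_def by auto
    show "finite A" "finite B" by (auto simp: A_def B_def)
  qed
qed

lemma contains_copy_double_starI:
  fixes A B :: "'a set"
  assumes fin: "finite A" "finite B" and card: "card A = n" "card B = m"
    and disj: "A \<inter> B = {}" "u \<noteq> v" "u \<notin> A \<union> B" "v \<notin> A \<union> B"
    and sub: "insert u (insert v (A \<union> B)) \<subseteq> verts G"
    and uv: "{u, v} \<in> edges G"
    and ua: "\<And>a. a \<in> A \<Longrightarrow> {u, a} \<in> edges G" and vb: "\<And>b. b \<in> B \<Longrightarrow> {v, b} \<in> edges G"
  shows "contains_copy G (double_star n m)"
proof -
  obtain g where g: "bij_betw g {1..n} A"
    using ex_bij_betw_nat_finite_1[OF fin(1)] card by auto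
  obtain h where h: "bij_betw h {1..m} B"
    using ex_bij_betw_nat_finite_1[OF fin(2)] card by auto
  have gA: "g i \<in> A" if "i \<in> {1..n}" for i using bij_betwE[OF g] that by blast
  have hB: "h i \<in> B" if "i \<in> {1..m}" for i using bij_betwE[OF h] that by blast
  define g' where "g' = g(0 := u)"
  define h' where "h' = h(0 := v)"
  \<comment> \<open>Index 0 is the centre of each star, so an enumeration of the leaves by 1, ...,
    \<open>l\<close> becomes an embedding of the star once 0 is sent to the centre.\<close>
  have extend: "bij_betw (k(0 := w)) {0..l} (insert w C)"
    if "bij_betw k {1..l} C" "w \<notin> C" for k :: "nat \<Rightarrow> 'a" and l w C
  proof -
    have "bij_betw (k(0 := w)) {1..l} C"
      using that(1) by (subst bij_betw_cong[of _ _ k]) auto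
    then have "bij_betw (k(0 := w)) ({1..l} \<union> {0}) (C \<union> {(k(0 := w)) 0})"
      using that(2) by (intro notIn_Un_bij_betw) auto
    moreover have "{1..l} \<union> {0} = {0..l}" by auto
    ultimately show ?thesis by simp
  qed
  have g': "inj_on g' {0..n}" "g' ` {0..n} = insert u A"
    using extend[OF g, of u] disj by (auto simp: g'_def bij_betw_def)
  have h': "inj_on h' {0..m}" "h' ` {0..m} = insert v B"
    using extend[OF h, of v] disj by (auto simp: h'_def bij_betw_def)
  define f where "f = case_sum g' h'"
  have f_simps: "f (Inl i) = g' i" "f (Inr i) = h' i" for i by (auto simp: f_def)
  have f_image: "f ` Inl ` S = g' ` S" "f ` Inr ` S = h' ` S" for S by (auto simp: f_def image_image)
  have "inj_on f (Inl ` {0..n} \<union> Inr ` {0..m})"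
  proof (subst inj_on_Un, intro conjI)
    show "inj_on f (Inl ` {0..n})" "inj_on f (Inr ` {0..m})"
      using g'(1) h'(1) by (auto simp: inj_on_def f_simps)
    have "f ` Inl ` {0..n} \<inter> f ` Inr ` {0..m} = {}" using disj by (auto simp: f_image g' h')
    then show "f ` (Inl ` {0..n} - Inr ` {0..m}) \<inter> f ` (Inr ` {0..m} - Inl ` {0..n}) = {}" by blast
  qed
  moreover have "f ` (Inl ` {0..n} \<union> Inr ` {0..m}) \<subseteq> verts G"
    using sub by (simp add: image_Un f_image g' h')
  moreover have "f ` e \<in> edges G" if "e \<in> edges (double_star n m)" for e
    using that uv ua[OF gA] vb[OF hB] unfolding edges_double_star
    by (auto simp: f_simps g'_def h'_def)
  ultimately show ?thesis by (auto simp: contains_copy_def verts_double_star)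
qed

section \<open>Balanced colourings and a colouring without monochromatic double stars\<close>

text \<open>
  The colouring minimises the sum of the squared colour degrees over \<open>L\<close>. Recolouring an edge
  cannot decrease this sum; averaging the resulting inequalities over all colours gives the bound.
\<close>

lemma balanced_edge_coloring:
  fixes E :: "'a set set"
  assumes "finite E" "finite L" "t > 0"
    and deg: "\<And>v. v \<in> L \<Longrightarrow> card {e \<in> E. v \<in> e} \<le> t * m"
    and meets: "\<And>e. e \<in> E \<Longrightarrow> e \<inter> L \<noteq> {}"
  obtains c :: "'a set \<Rightarrow> nat"
  where "c \<in> E \<rightarrow> {..<t}"
    and "\<And>e. e \<in> E \<Longrightarrow> \<exists>v\<in>e. card {e' \<in> E. v \<in> e' \<and> c e' = c e} \<le> m"
proof -
  define d where "d c a v = card {e \<in> E. v \<in> e \<and> c e = a}" for c :: "'a set \<Rightarrow> nat" and a v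
  define pot where "pot c = (\<Sum>v\<in>L. \<Sum>a<t. (d c a v)\<^sup>2)" for c
  have "(\<lambda>_. 0) \<in> E \<rightarrow> {..<t}" using \<open>t > 0\<close> by auto
  then obtain c where c: "c \<in> E \<rightarrow> {..<t}" and min: "\<And>c'. c' \<in> E \<rightarrow> {..<t} \<Longrightarrow> pot c \<le> pot c'"
    using ex_has_least_nat[of "\<lambda>c. c \<in> E \<rightarrow> {..<t}" _ pot] by blast
  have "\<exists>v\<in>e. d c (c e) v \<le> m" if e: "e \<in> E" for e
  proof (rule ccontr)
    assume "\<not> (\<exists>v\<in>e. d c (c e) v \<le> m)"
    then have big: "d c (c e) v \<ge> m + 1" if "v \<in> e" for v using that by force
    define a where "a = c e"
    have a: "a < t" using c e by (auto simp: a_def)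
    define S where "S = L \<inter> e"
    have S: "finite S" "S \<noteq> {}" "S \<subseteq> L" using meets[OF e] \<open>finite L\<close> by (auto simp: S_def)
    \<comment> \<open>Moving \<open>e\<close> from colour \<open>a\<close> to \<open>b\<close>
      replaces \<open>d_a\<close>, \<open>d_b\<close> by \<open>d_a - 1\<close>,
      \<open>d_b + 1\<close> at each end, so the squares change by
      \<open>2 * (d_b - d_a + 1)\<close>. Only ends in \<open>L\<close> enter \<open>pot\<close>,
      hence the sum over \<open>S\<close>.\<close>
    have step: "0 \<le> (\<Sum>v\<in>S. int (d c b v) - int (d c a v) + 1)" if b: "b < t" "b \<noteq> a" for b
    proof -
      define c' where "c' = c(e := b)"
      have db: "d c' b v = d c b v + 1" if "v \<in> e" for v
      proof -
        have "{e' \<in> E. v \<in> e' \<and> c' e' = b} = insert e {e' \<in> E. v \<in> e' \<and> c e' = b}"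
          using that e by (auto simp: c'_def)
        then show ?thesis using \<open>finite E\<close> b by (auto simp: d_def a_def)
      qed
      have da: "d c a v = d c' a v + 1" if "v \<in> e" for v
      proof -
        have "{e' \<in> E. v \<in> e' \<and> c e' = a} = insert e {e' \<in> E. v \<in> e' \<and> c' e' = a}"
          using that e b by (auto simp: c'_def a_def)
        then show ?thesis using \<open>finite E\<close> b by (auto simp: d_def c'_def)
      qed
      have d_other: "d c' x v = d c x v" if "x \<noteq> a" "x \<noteq> b" for x v
        unfolding d_def using that by (intro arg_cong[where f=card]) (auto simp: c'_def a_def)
      have d_out: "d c' x v = d c x v" if "v \<notin> e" for x v
        unfolding d_def using that by (intro arg_cong[where f=card]) (auto simp: c'_def)
      have diff: "(\<Sum>x<t. (int (d c' x v))\<^sup>2) - (\<Sum>x<t. (int (d c x v))\<^sup>2) =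
          (if v \<in> e then 2 * (int (d c b v) - int (d c a v) + 1) else 0)" for v
      proof (cases "v \<in> e")
        case True
        have "(\<Sum>x<t. (int (d c' x v))\<^sup>2) - (\<Sum>x<t. (int (d c x v))\<^sup>2) =
            (\<Sum>x<t. (int (d c' x v))\<^sup>2 - (int (d c x v))\<^sup>2)"
          by (simp add: sum_subtractf)
        also have "\<dots> = (\<Sum>x\<in>{a, b}. (int (d c' x v))\<^sup>2 - (int (d c x v))\<^sup>2)"
          using a b by (intro sum.mono_neutral_right) (auto simp: d_other)
        also have "\<dots> = 2 * (int (d c b v) - int (d c a v) + 1)"
          using b db[OF True] da[OF True] by (simp add: power2_eq_square algebra_simps)
        finally show ?thesis using True by simp
      qed (simp add: d_out)
      have "c' \<in> E \<rightarrow> {..<t}" using c b by (auto simp: c'_def)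
      from min[OF this] have "int (pot c) \<le> int (pot c')" by simp
      then have "0 \<le> (\<Sum>v\<in>L. (\<Sum>x<t. (int (d c' x v))\<^sup>2) - (\<Sum>x<t. (int (d c x v))\<^sup>2))"
        by (simp add: pot_def sum_subtractf)
      also have "\<dots> = (\<Sum>v\<in>S. 2 * (int (d c b v) - int (d c a v) + 1))"
        unfolding diff S_def by (rule sum.inter_restrict[OF \<open>finite L\<close>, symmetric])
      also have "\<dots> = 2 * (\<Sum>v\<in>S. int (d c b v) - int (d c a v) + 1)"
        by (simp add: sum_distrib_left)
      finally show ?thesis by simp
    qed
    have d_sum: "(\<Sum>b<t. int (d c b v)) \<le> int (t * m)" if "v \<in> L" for v
    proof -
      have "(\<Sum>b<t. d c b v) = card (\<Union>b<t. {e \<in> E. v \<in> e \<and> c e = b})"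
        unfolding d_def using \<open>finite E\<close> by (subst card_UN_disjoint) auto
      also have "(\<Union>b<t. {e \<in> E. v \<in> e \<and> c e = b}) = {e \<in> E. v \<in> e}" using c by auto
      finally show ?thesis using deg[OF that] by (simp flip: of_nat_sum of_nat_mult)
    qed
    have "0 \<le> (\<Sum>b\<in>{..<t}-{a}. \<Sum>v\<in>S. int (d c b v) - int (d c a v) + 1)"
      by (rule sum_nonneg) (use step in auto)
    also have "\<dots> = (\<Sum>v\<in>S. \<Sum>b\<in>{..<t}-{a}. int (d c b v) - int (d c a v) + 1)"
      by (rule sum.swap)
    \<comment> \<open>The omitted term \<open>b = a\<close> equals 1. Over all \<open>b\<close> the
      degrees sum to at most \<open>t * m\<close>, while \<open>d_a - 1 \<ge> m\<close> contributes
      at least \<open>t * m\<close> with negative sign; so each end in \<open>S\<close> leaves at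
      most -1, and \<open>S\<close> is nonempty.\<close>
    also have "\<dots> \<le> (\<Sum>v\<in>S. -1)"
    proof (rule sum_mono)
      fix v assume v: "v \<in> S"
      have "(\<Sum>b\<in>{..<t}-{a}. int (d c b v) - int (d c a v) + 1) =
          (\<Sum>b<t. int (d c b v) - int (d c a v) + 1) - 1"
        using a by (simp add: sum_diff1)
      also have "\<dots> = (\<Sum>b<t. int (d c b v)) - int t * (int (d c a v) - 1) - 1"
        by (simp add: sum.distrib sum_subtractf algebra_simps)
      also have "int t * (int (d c a v) - 1) \<ge> int t * int m"
        using big[of v] v by (intro mult_left_mono) (auto simp: S_def a_def)
      then have "(\<Sum>b<t. int (d c b v)) - int t * (int (d c a v) - 1) - 1 \<le> -1"
        using d_sum[of v] v S(3) by auto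
      finally show "(\<Sum>b\<in>{..<t}-{a}. int (d c b v) - int (d c a v) + 1) \<le> -1" .
    qed
    also have "\<dots> < 0" using S by (simp add: card_gt_0_iff)
    finally show False by simp
  qed
  then show ?thesis using that[OF c] by (auto simp: d_def)
qed

lemma color_degree_ge:
  assumes "finite E" "finite A" "u \<notin> A" "\<And>a. a \<in> A \<Longrightarrow> {u, a} \<in> E"
  shows "card A \<le> card {e \<in> E. u \<in> e}"
proof -
  have "inj_on (\<lambda>a. {u, a}) A" using assms(3) by (auto simp: inj_on_def doubleton_eq_iff)
  then have "card A = card ((\<lambda>a. {u, a}) ` A)" by (simp add: card_image)
  also have "\<dots> \<le> card {e \<in> E. u \<in> e}" using assms by (intro card_mono) auto
  finally show ?thesis .
qed

text \<open>For each colour \<open>c < s\<close>, \<open>key c\<close> partitions \<open>H\<close>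
  into blocks, and an edge inside \<open>H\<close> takes a colour for which both its ends lie in one
  block. A connected subgraph of that colour then stays within a block, which is too small for the
  double star. All other edges have an end of degree at most \<open>t * m\<close>, so the balanced
  colouring applies to them.\<close>

lemma not_ramsey_graph_double_star:
  fixes G :: "'a ugraph" and key :: "nat \<Rightarrow> 'a \<Rightarrow> 'k"
  assumes G: "fin_simple_graph G" and nm: "m \<le> n" and t: "t > 0"
    and H: "H = {v \<in> verts G. t * m < card {e \<in> edges G. v \<in> e}}"
    and cover: "\<And>u v. u \<in> H \<Longrightarrow> v \<in> H \<Longrightarrow> \<exists>c<s. key c u = key c v"
    and small: "\<And>c k. c < s \<Longrightarrow> card {v \<in> H. key c v = k} < n + m + 2"
  shows "\<not> ramsey_graph (s + t) G (double_star n m)"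
proof
  assume R: "ramsey_graph (s + t) G (double_star n m)"
  have finV: "finite (verts G)" and E2: "edges G \<subseteq> nsets (verts G) 2"
    using G by (auto simp: fin_simple_graph_def)
  have finE: "finite (edges G)" using E2 finV finite_imp_finite_nsets finite_subset by blast
  have finH: "finite H" using finV H by auto
  define E where "E = {e \<in> edges G. \<not> e \<subseteq> H}"
  have finE': "finite E" using finE by (simp add: E_def)
  have "\<exists>c0. c0 \<in> E \<rightarrow> {..<t} \<and>
      (\<forall>e\<in>E. \<exists>v\<in>e. card {e' \<in> E. v \<in> e' \<and> c0 e' = c0 e} \<le> m)"
  proof (rule balanced_edge_coloring[OF finE', of "verts G - H" t m])
    fix v assume "v \<in> verts G - H"
    then have "card {e \<in> edges G. v \<in> e} \<le> t * m" by (auto simp: H)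
    moreover have "card {e \<in> E. v \<in> e} \<le> card {e \<in> edges G. v \<in> e}"
      using finE by (intro card_mono) (auto simp: E_def)
    ultimately show "card {e \<in> E. v \<in> e} \<le> t * m" by linarith
  next
    fix e assume "e \<in> E"
    then show "e \<inter> (verts G - H) \<noteq> {}" using E2 by (auto simp: E_def nsets_def)
  qed (use finV t in auto)
  then obtain c0 where c0: "c0 \<in> E \<rightarrow> {..<t}"
    and bal: "\<And>e. e \<in> E \<Longrightarrow> \<exists>v\<in>e. card {e' \<in> E. v \<in> e' \<and> c0 e' = c0 e} \<le> m"
    by blast
  define good where "good e i \<longleftrightarrow> i < s \<and> (\<forall>u\<in>e. \<forall>v\<in>e. key i u = key i v)" for e i
  have ex_good: "\<exists>i. good e i" if e: "e \<in> edges G" "e \<subseteq> H" for e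
  proof -
    have "card e = 2" using e E2 by (auto simp: nsets_def)
    then obtain u v where uv: "e = {u, v}" by (auto simp: card_2_iff)
    then obtain i where "i < s" "key i u = key i v" using cover[of u v] e by auto
    then show ?thesis by (auto simp: good_def uv intro!: exI[of _ i])
  qed
  \<comment> \<open>Shifting \<open>c0\<close> by \<open>s\<close> separates the palettes: each
    colour is used either only inside \<open>H\<close> or only on \<open>E\<close>.\<close>
  define c where "c e = (if e \<subseteq> H then SOME i. good e i else s + c0 e)" for e
  have c_good: "good e (c e)" if "e \<in> edges G" "e \<subseteq> H" for e
    using someI_ex[OF ex_good[OF that]] that by (simp add: c_def)
  have c_high: "c e = s + c0 e \<and> c0 e < t" if "e \<in> edges G" "\<not> e \<subseteq> H" for e
    using c0 that by (auto simp: c_def E_def)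
  have "c \<in> edges G \<rightarrow> {..<s + t}"
  proof
    fix e assume e: "e \<in> edges G"
    show "c e \<in> {..<s + t}"
      using c_good[OF e] c_high[OF e] by (cases "e \<subseteq> H") (auto simp: good_def)
  qed
  with R obtain i where i: "i < s + t" "contains_copy (color_class G c i) (double_star n m)"
    by (auto simp: ramsey_graph_def)
  from i(2) obtain u v A B where fin: "finite A" "finite B" and card: "card A = n" "card B = m"
    and disj: "A \<inter> B = {}" "u \<noteq> v" "u \<notin> A \<union> B" "v \<notin> A \<union> B"
    and uv: "{u, v} \<in> edges G" "c {u, v} = i"
    and ua: "\<And>a. a \<in> A \<Longrightarrow> {u, a} \<in> edges G \<and> c {u, a} = i"
    and vb: "\<And>b. b \<in> B \<Longrightarrow> {v, b} \<in> edges G \<and> c {v, b} = i"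
    by (rule contains_copy_double_starE) (auto simp: color_class_def)
  show False
  proof (cases "i < s")
    case True
    \<comment> \<open>Edges of colour \<open>i\<close> do not leave a block of \<open>key i\<close>,
      so the whole copy lies in the block of \<open>u\<close>.\<close>
    have mono: "x \<in> H \<and> y \<in> H \<and> key i x = key i y"
      if "{x, y} \<in> edges G" "c {x, y} = i" for x y
    proof -
      have "{x, y} \<subseteq> H" using c_high[of "{x, y}"] that True by fastforce
      moreover from this have "good {x, y} i" using c_good that by metis
      ultimately show ?thesis unfolding good_def by blast
    qed
    have "insert u (insert v (A \<union> B)) \<subseteq> {w \<in> H. key i w = key i u}"
      using mono uv ua vb by fastforce
    then have "card (insert u (insert v (A \<union> B))) \<le> card {w \<in> H. key i w = key i u}"
      using finH by (intro card_mono) auto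
    moreover have "card (insert u (insert v (A \<union> B))) = n + m + 2"
      using fin card disj by (simp add: card_Un_disjoint)
    ultimately show False using small[OF True, of "key i u"] by simp
  next
    case False
    have low: "e \<in> E \<and> c0 e = i - s" if "e \<in> edges G" "c e = i" for e
    proof -
      have "\<not> e \<subseteq> H" using c_good[of e] that False by (auto simp: good_def)
      then show ?thesis using c_high[of e] that by (auto simp: E_def)
    qed
    define F where "F = {e \<in> E. c0 e = i - s}"
    have finF: "finite F" using finE' by (simp add: F_def)
    have inF: "e \<in> F" if "e \<in> edges G" "c e = i" for e using low[OF that] by (simp add: F_def)
    \<comment> \<open>Counting the central edge with the leaf edges, \<open>u\<close> has colour
      degree at least \<open>n + 1\<close> and \<open>v\<close> at least \<open>m + 1\<close>. Both
      exceed \<open>m\<close>, against the balanced end of \<open>{u, v}\<close>.\<close>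
    have "card (insert v A) \<le> card {e \<in> F. u \<in> e}"
      using finF fin disj uv ua by (intro color_degree_ge) (auto intro!: inF)
    then have du: "card {e \<in> F. u \<in> e} > m" using fin disj card nm by simp
    have "card (insert u B) \<le> card {e \<in> F. v \<in> e}"
      using finF fin disj uv vb by (intro color_degree_ge) (auto intro!: inF simp: insert_commute)
    then have dv: "card {e \<in> F. v \<in> e} > m" using fin disj card by simp
    have "c0 {u, v} = i - s" "{u, v} \<in> E" using low uv by auto
    then obtain w where w: "w \<in> {u, v}" "card {e' \<in> E. w \<in> e' \<and> c0 e' = i - s} \<le> m"
      using bal[of "{u, v}"] by auto
    have eq: "{e' \<in> E. w \<in> e' \<and> c0 e' = i - s} = {e \<in> F. w \<in> e}" by (auto simp: F_def)
    show False using w(1) w(2)[unfolded eq] du dv by auto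
  qed
qed

text \<open>Markov's inequality applied to the degree sum, which double counting of incidences shows
  to be twice the number of edges.\<close>

lemma card_high_degree:
  assumes G: "fin_simple_graph G"
  shows "card {v \<in> verts G. k < card {e \<in> edges G. v \<in> e}} * (k + 1) \<le> 2 * card (edges G)"
    (is "card ?H * _ \<le> _")
proof -
  have finV: "finite (verts G)" and E2: "edges G \<subseteq> nsets (verts G) 2"
    using G by (auto simp: fin_simple_graph_def)
  have finE: "finite (edges G)" using E2 finV finite_imp_finite_nsets finite_subset by blast
  have "card ?H * (k + 1) = (\<Sum>v\<in>?H. k + 1)" by simp
  also have "\<dots> \<le> (\<Sum>v\<in>?H. card {e \<in> edges G. v \<in> e})" by (intro sum_mono) auto
  also have "\<dots> \<le> (\<Sum>v\<in>verts G. card {e \<in> edges G. v \<in> e})"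
    using finV by (intro sum_mono2) auto
  also have "\<dots> = (\<Sum>e\<in>edges G. card {v \<in> verts G. v \<in> e})"
    using sum.swap_restrict[OF finV finE, of "\<lambda>_ _. 1::nat" "\<lambda>v e. v \<in> e"] by simp
  also have "\<dots> = (\<Sum>e\<in>edges G. 2)"
  proof (rule sum.cong)
    fix e assume "e \<in> edges G"
    then have "e \<subseteq> verts G" "card e = 2" using E2 by (auto simp: nsets_def)
    moreover from this have "{v \<in> verts G. v \<in> e} = e" by auto
    ultimately show "card {v \<in> verts G. v \<in> e} = 2" by simp
  qed simp
  finally show ?thesis by simp
qed

section \<open>Round-robin factorization and its blow-up\<close>

text \<open>
  The round-robin 1-factorization of the complete graph on \<open>{0..s}\<close>: colour \<open>c\<close> pairs \<open>i\<close> with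
  \<open>c - i\<close> modulo \<open>s\<close>, and the fixed point of this involution with the extra vertex \<open>s\<close>.
  \<open>K c i\<close> names the pair containing \<open>i\<close>; as a set it omits the extra vertex.
\<close>

lemma round_robin:
  fixes s :: nat
  assumes "odd s"
  shows "\<exists>K :: nat \<Rightarrow> nat \<Rightarrow> int set.
    (\<forall>i\<le>s. \<forall>j\<le>s. \<exists>c<s. K c i = K c j) \<and> (\<forall>c k. card {i. i \<le> s \<and> K c i = k} \<le> 2)"
proof -
  have s: "s > 0" using assms by (auto intro: Nat.gr0I)
  define K where "K c i = (if i < s then {int i, (int c - int i) mod int s}
    else {j. 0 \<le> j \<and> j < int s \<and> (2 * j) mod int s = int c})" for c i
  \<comment> \<open>As \<open>s\<close> is odd, 2 is invertible modulo \<open>s\<close>, so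
    \<open>i\<close> is the only fixed point for colour \<open>2 * i mod s\<close>; this is the
    colour pairing \<open>i\<close> with the extra vertex.\<close>
  have half: "{j. 0 \<le> j \<and> j < int s \<and> (2 * j) mod int s = int (2 * i mod s)} = {int i}"
    if "i < s" for i
  proof -
    have "j = int i" if j: "0 \<le> j" "j < int s" "(2 * j) mod int s = int (2 * i mod s)" for j
    proof -
      have "int s dvd 2 * j - 2 * int i" using j(3) by (simp add: zmod_int mod_eq_dvd_iff)
      then have "int s dvd 2 * (j - int i)" by (simp add: algebra_simps)
      moreover have "coprime (int s) 2" using assms by simp
      ultimately have "int s dvd j - int i" using coprime_dvd_mult_right_iff by blast
      then show ?thesis using j \<open>i < s\<close> 
        by (metis mod_eq_dvd_iff mod_pos_pos_trivial of_nat_0_le_iff of_nat_less_iff)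
    qed
    then show ?thesis using that by (auto simp: zmod_int)
  qed
  have K_top: "\<exists>c<s. K c i = K c s" if "i < s" for i
  proof (intro exI conjI)
    show "2 * i mod s < s" using s by simp
    have "(int (2 * i mod s) - int i) mod int s = int i"
      using that by (simp add: zmod_int mod_diff_left_eq)
    then show "K (2 * i mod s) i = K (2 * i mod s) s"
      using that half[OF that] by (simp add: K_def)
  qed
  have cover: "\<exists>c<s. K c i = K c j" if "i \<le> s" "j \<le> s" for i j
  proof (cases "i < s \<and> j < s")
    case True
    \<comment> \<open>The involution of colour \<open>(i + j) mod s\<close> swaps \<open>i\<close>
      and \<open>j\<close>, so both keys are the same set.\<close>
    have "(int ((i + j) mod s) - int i) mod int s = int j"
      "(int ((i + j) mod s) - int j) mod int s = int i"
      using True by (simp_all add: zmod_int mod_diff_left_eq)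
    then have "K ((i + j) mod s) i = K ((i + j) mod s) j"
      using True by (auto simp: K_def)
    then show ?thesis using s by (intro exI[of _ "(i + j) mod s"]) auto
  next
    case False
    then consider "i = s" "j = s" | "i = s" "j < s" | "i < s" "j = s" using \<open>i \<le> s\<close> \<open>j \<le> s\<close> by fastforce
    then show ?thesis using K_top s by cases (auto, metis)
  qed
  have "card {i. i \<le> s \<and> K c i = k} \<le> 2" for c k
  proof (cases "K c s = k")
    case False
    show ?thesis
    proof (cases "\<exists>i0<s. K c i0 = k")
      case True
      then obtain i0 where i0: "i0 < s" "K c i0 = k" by blast
      \<comment> \<open>The extra vertex is not in this class, so every member lies in its own key
        \<open>k\<close>, a set of at most two elements.\<close>
      have "int ` {i. i \<le> s \<and> K c i = k} \<subseteq> k"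
        using False by (auto simp: K_def split: if_splits)
      moreover have k: "k = {int i0, (int c - int i0) mod int s}" using i0 by (simp add: K_def)
      ultimately have "card (int ` {i. i \<le> s \<and> K c i = k}) \<le> card k" by (intro card_mono) auto
      also have "\<dots> \<le> 2" unfolding k by (simp add: card_insert_if)
      finally show ?thesis by (simp add: card_image)
    next
      case none: False
      then have "{i. i \<le> s \<and> K c i = k} = {}" using False le_neq_implies_less by blast
      then show ?thesis by (simp only: card.empty)
    qed
  next
    case True
    \<comment> \<open>The class now contains \<open>s\<close>. Any other member lies in its own key,
      which is \<open>K c s\<close>, and is therefore a fixed point of the involution; there is at
      most one.\<close>
    have "{i. i \<le> s \<and> K c i = k} \<subseteq> insert s {i. i < s \<and> int i \<in> k \<and> k = K c s}"
      using True by (auto simp: K_def split: if_splits)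
    moreover have "card {i. i < s \<and> int i \<in> k \<and> k = K c s} \<le> 1"
    proof -
      have "i = j" if "i < s" "int i \<in> K c s" "j < s" "int j \<in> K c s" for i j
      proof -
        have "(2 * int i) mod int s = int c" "(2 * int j) mod int s = int c"
          using that by (auto simp: K_def)
        then have "2 * j mod s = c" by (metis of_nat_eq_iff of_nat_mult of_nat_numeral zmod_int)
        then show ?thesis using half[OF \<open>j < s\<close>] that by (auto simp: K_def)
      qed
      then show ?thesis by (subst card_le_Suc0_iff_eq[unfolded One_nat_def[symmetric]]) auto
    qed
    moreover have "card (insert s {i. i < s \<and> int i \<in> k \<and> k = K c s}) \<le>
        Suc (card {i. i < s \<and> int i \<in> k \<and> k = K c s})"
      by (rule card_insert_le_m1) simp_all
    ultimately show ?thesis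
      using card_mono[of "insert s {i. i < s \<and> int i \<in> k \<and> k = K c s}" "{i. i \<le> s \<and> K c i = k}"]
      by simp
  qed
  then show ?thesis using cover by blast
qed

text \<open>Number \<open>H\<close> and cut it into at most \<open>s + 1\<close> consecutive blocks
  of length at most \<open>q\<close>. Each vertex inherits the key of its block \<open>p v\<close>;
  a class of keys merges at most two blocks.\<close>

lemma round_robin_blowup:
  fixes H :: "'a set"
  assumes "odd s" "finite H" "card H \<le> (s + 1) * q" "q > 0"
  shows "\<exists>key :: nat \<Rightarrow> 'a \<Rightarrow> int set. (\<forall>u\<in>H. \<forall>v\<in>H. \<exists>c<s. key c u = key c v) \<and>
    (\<forall>c k. card {v \<in> H. key c v = k} \<le> 2 * q)"
proof -
  obtain h where h: "bij_betw h H {0..<card H}"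
    using ex_bij_betw_finite_nat[OF assms(2)] by blast
  define p where "p v = h v div q" for v
  have p: "p v \<le> s" if "v \<in> H" for v
  proof -
    have "h v < (s + 1) * q" using bij_betwE[OF h] that assms(3) by fastforce
    then have "p v < s + 1" unfolding p_def using assms(4) by (simp add: less_mult_imp_div_less)
    then show ?thesis by simp
  qed
  have fibre: "card {v \<in> H. p v = i} \<le> q" for i
  proof -
    have "card {v \<in> H. p v = i} \<le> card {i * q..<i * q + q}"
    proof (rule card_inj_on_le[of h])
      show "inj_on h {v \<in> H. p v = i}"
        using bij_betw_imp_inj_on[OF h] by (rule inj_on_subset) auto
      show "h ` {v \<in> H. p v = i} \<subseteq> {i * q..<i * q + q}"
        using assms(4) by (auto simp: p_def dividend_less_div_times add.commute)
    qed simp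
    then show ?thesis by simp
  qed
  obtain K :: "nat \<Rightarrow> nat \<Rightarrow> int set"
    where K: "\<And>i j. i \<le> s \<Longrightarrow> j \<le> s \<Longrightarrow> \<exists>c<s. K c i = K c j"
      "\<And>c k. card {i. i \<le> s \<and> K c i = k} \<le> 2"
    using round_robin[OF assms(1)] by blast
  show ?thesis
  proof (intro exI[of _ "\<lambda>c v. K c (p v)"] conjI ballI allI)
    show "\<exists>c<s. K c (p u) = K c (p v)" if "u \<in> H" "v \<in> H" for u v
      using K(1) p that by blast
    show "card {v \<in> H. K c (p v) = k} \<le> 2 * q" for c k
    proof -
      have "{v \<in> H. K c (p v) = k} \<subseteq> (\<Union>i\<in>{i. i \<le> s \<and> K c i = k}. {v \<in> H. p v = i})"
        using p by auto
      then have "card {v \<in> H. K c (p v) = k} \<le>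
          card (\<Union>i\<in>{i. i \<le> s \<and> K c i = k}. {v \<in> H. p v = i})"
        using assms(2) by (intro card_mono) auto
      also have "\<dots> \<le> (\<Sum>i\<in>{i. i \<le> s \<and> K c i = k}. card {v \<in> H. p v = i})"
        by (rule card_UN_le) simp
      also have "\<dots> \<le> (\<Sum>i\<in>{i. i \<le> s \<and> K c i = k}. q)" by (intro sum_mono fibre)
      also have "\<dots> \<le> 2 * q" using K(2)[of c k] by simp
      finally show ?thesis .
    qed
  qed
qed

section \<open>Lower bounds on the number of edges\<close>

text \<open>The case \<open>s = t = 1\<close> with a constant key: \<open>H\<close> is a single
  block, so it must have at least \<open>n + m + 2\<close> vertices, each of degree above
  \<open>m\<close>.\<close>

lemma ramsey_two_colors_edges:
  assumes G: "fin_simple_graph G" and R: "ramsey_graph 2 G (double_star n m)" and nm: "m \<le> n"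
  shows "(m + 1) * (n + m + 2) \<le> 2 * card (edges G)"
proof -
  define H where "H = {v \<in> verts G. 1 * m < card {e \<in> edges G. v \<in> e}}"
  have "card H \<ge> n + m + 2"
  proof (rule ccontr)
    assume small: "\<not> card H \<ge> n + m + 2"
    have "\<not> ramsey_graph (1 + 1) G (double_star n m)"
      by (rule not_ramsey_graph_double_star[OF G nm _ H_def, of 1 "\<lambda>_ _. ()"]) (use small in auto)
    then show False using R by (simp add: numeral_2_eq_2)
  qed
  then have "(m + 1) * (n + m + 2) \<le> card H * (m + 1)" by (subst mult.commute) (rule mult_right_mono, auto)
  also have "\<dots> \<le> 2 * card (edges G)" using card_high_degree[OF G, of m] by (simp add: H_def)
  finally show ?thesis .
qed

lemma ramsey_edges:
  assumes G: "fin_simple_graph G" and R: "ramsey_graph (s + t) G (double_star n m)"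
    and nm: "m \<le> n" "1 \<le> m" and st: "odd s" "t > 0"
  shows "((s + 1) * ((n + m + 1) div 2) + 1) * (t * m) \<le> 2 * card (edges G)"
proof -
  \<comment> \<open>The largest block length for which two blocks together have fewer than
    \<open>n + m + 2\<close> vertices.\<close>
  define q where "q = (n + m + 1) div 2"
  define H where "H = {v \<in> verts G. t * m < card {e \<in> edges G. v \<in> e}}"
  have finH: "finite H" using G by (auto simp: fin_simple_graph_def H_def)
  have q: "q > 0" "2 * q < n + m + 2" using nm by (auto simp: q_def)
  have "card H \<ge> (s + 1) * q + 1"
  proof (rule ccontr)
    assume "\<not> card H \<ge> (s + 1) * q + 1"
    then have le: "card H \<le> (s + 1) * q" by simp
    obtain key :: "nat \<Rightarrow> _ \<Rightarrow> int set"
      where key: "\<And>u v. u \<in> H \<Longrightarrow> v \<in> H \<Longrightarrow> \<exists>c<s. key c u = key c v"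
        "\<And>c k. card {v \<in> H. key c v = k} \<le> 2 * q"
      using round_robin_blowup[OF st(1) finH le q(1)] by blast
    have "\<not> ramsey_graph (s + t) G (double_star n m)"
      using le_less_trans[OF key(2) q(2)]
      by (intro not_ramsey_graph_double_star[OF G nm(1) st(2) H_def key(1)])
    then show False using R by contradiction
  qed
  then have "((s + 1) * q + 1) * (t * m) \<le> card H * (t * m + 1)" by (intro mult_mono) auto
  also have "\<dots> \<le> 2 * card (edges G)" using card_high_degree[OF G, of "t * m"] by (simp add: H_def)
  finally show ?thesis by (simp add: q_def)
qed

section \<open>Upper bound from a complete bipartite host graph\<close>

definition complete_bipartite :: "nat \<Rightarrow> nat \<Rightarrow> nat ugraph" where
  "complete_bipartite a b = ({..<a + b}, (\<lambda>(x, y). {x, y}) ` ({..<a} \<times> {a..<a + b}))"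

lemma fin_simple_graph_complete_bipartite: "fin_simple_graph (complete_bipartite a b)"
  by (auto simp: fin_simple_graph_def complete_bipartite_def nsets_def card_insert_if)

lemma inj_on_complete_bipartite: "inj_on (\<lambda>(x, y). {x, y}) ({..<a} \<times> {a..<a + b::nat})"
  by (auto simp: inj_on_def doubleton_eq_iff)

lemma card_edges_complete_bipartite: "card (edges (complete_bipartite a b)) = a * b"
  by (simp add: complete_bipartite_def card_image[OF inj_on_complete_bipartite])

lemma ramsey_complete_bipartite:
  assumes "r > 0" "n > 0"
  shows "ramsey_graph r (complete_bipartite (2 * r * n + 1) (2 * r * m + 1)) (double_star n m)"
  unfolding ramsey_graph_def
proof
  define X where "X = {..<2 * r * n + 1}"
  define Y where "Y = {2 * r * n + 1..<2 * r * n + 1 + (2 * r * m + 1)}"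
  let ?G = "complete_bipartite (2 * r * n + 1) (2 * r * m + 1)"
  fix c assume c: "c \<in> edges ?G \<rightarrow> {..<r}"
  have edge: "{x, y} \<in> edges ?G" if "x \<in> X" "y \<in> Y" for x y
    using that unfolding complete_bipartite_def X_def Y_def by force
  have finX: "finite X" "finite Y" and cardX: "card X = 2 * r * n + 1" "card Y = 2 * r * m + 1"
    and disj: "X \<inter> Y = {}" and vG: "verts ?G = X \<union> Y"
    by (auto simp: X_def Y_def complete_bipartite_def)
  define P where "P i = {(x, y) \<in> X \<times> Y. c {x, y} = i}" for i
  have finP: "finite (P i)" for i
    using finX by (intro finite_subset[of "P i" "X \<times> Y"]) (auto simp: P_def)
  \<comment> \<open>Pigeonhole. The threshold is \<open>card X * m + card Y * n\<close>, the most
    edges of one colour that can have an end of colour degree at most \<open>m\<close> in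
    \<open>X\<close> or at most \<open>n\<close> in \<open>Y\<close>.\<close>
  have "\<exists>i<r. card (P i) > 4 * r * n * m + n + m"
  proof (rule ccontr)
    assume "\<not> (\<exists>i<r. card (P i) > 4 * r * n * m + n + m)"
    then have le: "card (P i) \<le> 4 * r * n * m + n + m" if "i < r" for i using that by force
    have "X \<times> Y = (\<Union>i<r. P i)" using c edge by (auto simp: P_def)
    then have "card (X \<times> Y) = card (\<Union>i<r. P i)" by simp
    also have "\<dots> \<le> (\<Sum>i<r. card (P i))" by (rule card_UN_le) simp
    also have "\<dots> \<le> (\<Sum>i<r. 4 * r * n * m + n + m)" using le by (intro sum_mono) auto
    also have "\<dots> = r * (4 * r * n * m + n + m)" by simp
    also have "\<dots> < (2 * r * n + 1) * (2 * r * m + 1)" by (simp add: algebra_simps)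
    finally show False by (simp add: card_cartesian_product cardX)
  qed
  then obtain i where i: "i < r" "card (P i) > 4 * r * n * m + n + m" by blast
  define NX where "NX x = {y \<in> Y. c {x, y} = i}" for x
  define NY where "NY y = {x \<in> X. c {x, y} = i}" for y
  have finN: "finite (NX x)" "finite (NY y)" for x y using finX by (auto simp: NX_def NY_def)
  have "\<exists>(x, y) \<in> P i. card (NX x) > m \<and> card (NY y) > n"
  proof (rule ccontr)
    assume none: "\<not> (\<exists>(x, y) \<in> P i. card (NX x) > m \<and> card (NY y) > n)"
    let ?A = "SIGMA x:{x \<in> X. card (NX x) \<le> m}. NX x"
    \<comment> \<open>\<open>?B\<close> lists its pairs with the \<open>Y\<close> end first, hence
      \<open>prod.swap\<close> below.\<close>
    let ?B = "SIGMA y:{y \<in> Y. card (NY y) \<le> n}. NY y"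
    have finA: "finite ?A" "finite ?B" using finX finN by (auto intro!: finite_SigmaI)
    have "P i \<subseteq> ?A \<union> prod.swap ` ?B"
    proof
      fix z assume "z \<in> P i"
      then obtain x y where z: "z = (x, y)" "(x, y) \<in> P i" by (cases z) auto
      then have "card (NX x) \<le> m \<or> card (NY y) \<le> n" using none by force
      then show "z \<in> ?A \<union> prod.swap ` ?B"
        using z by (auto simp: P_def NX_def NY_def image_iff)
    qed
    then have "card (P i) \<le> card (?A \<union> prod.swap ` ?B)" using finA by (intro card_mono) auto
    also have "\<dots> \<le> card ?A + card (prod.swap ` ?B)" by (rule card_Un_le)
    also have "\<dots> \<le> card ?A + card ?B" using finA card_image_le by auto
    also have "card ?A = (\<Sum>x\<in>{x \<in> X. card (NX x) \<le> m}. card (NX x))"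
      using finX finN by (intro card_SigmaI) auto
    also have "\<dots> \<le> (\<Sum>x\<in>{x \<in> X. card (NX x) \<le> m}. m)" by (intro sum_mono) auto
    also have "\<dots> \<le> card X * m" using finX by (auto intro!: card_mono)
    also have "card ?B = (\<Sum>y\<in>{y \<in> Y. card (NY y) \<le> n}. card (NY y))"
      using finX finN by (intro card_SigmaI) auto
    also have "\<dots> \<le> (\<Sum>y\<in>{y \<in> Y. card (NY y) \<le> n}. n)" by (intro sum_mono) auto
    also have "\<dots> \<le> card Y * n" using finX by (auto intro!: card_mono)
    finally have "card (P i) \<le> card X * m + card Y * n" by simp
    then show False using i(2) by (simp add: cardX algebra_simps)
  qed
  then obtain x y where xy: "x \<in> X" "y \<in> Y" "c {x, y} = i"
    and big: "card (NX x) > m" "card (NY y) > n"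
    by (auto simp: P_def)
  \<comment> \<open>The strict bounds leave room to remove the other centre from each neighbourhood.
    The leaves of \<open>y\<close> lie in \<open>X\<close> and those of \<open>x\<close> in
    \<open>Y\<close>, so \<open>y\<close> is the centre with \<open>n\<close> leaves and the leaf
    sets are disjoint.\<close>
  have "m \<le> card (NX x - {y})" "n \<le> card (NY y - {x})"
    using big finN by (auto simp: card_Diff_singleton_if)
  then obtain A B where A: "A \<subseteq> NY y - {x}" "card A = n" "finite A"
    and B: "B \<subseteq> NX x - {y}" "card B = m" "finite B"
    by (meson obtain_subset_with_card_n)
  have AX: "A \<subseteq> X" "x \<notin> A" and BY: "B \<subseteq> Y" "y \<notin> B" using A B by (auto simp: NX_def NY_def)
  have "contains_copy (color_class ?G c i) (double_star n m)"
  proof (rule contains_copy_double_starI)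
    show "finite A" "finite B" "card A = n" "card B = m" using A B by auto
    show "A \<inter> B = {}" "y \<noteq> x" "y \<notin> A \<union> B" "x \<notin> A \<union> B" using AX BY xy disj by auto
    show "insert y (insert x (A \<union> B)) \<subseteq> verts (color_class ?G c i)"
      using AX BY xy vG by (auto simp: color_class_def)
    show "{y, x} \<in> edges (color_class ?G c i)"
      using xy edge by (auto simp: color_class_def insert_commute)
    show "{y, a} \<in> edges (color_class ?G c i)" if "a \<in> A" for a
      using that A xy edge by (auto simp: color_class_def NY_def insert_commute)
    show "{x, b} \<in> edges (color_class ?G c i)" if "b \<in> B" for b
      using that B xy edge by (auto simp: color_class_def NX_def)
  qed
  then show "\<exists>i<r. contains_copy (color_class ?G c i) (double_star n m)" using i by blast
qed

section \<open>Choice of the palette sizes and the final bounds\<close>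

text \<open>Take \<open>s\<close> and \<open>t\<close> nearly equal with \<open>s\<close> odd,
  according to \<open>r\<close> modulo 4. Then \<open>(s + 1) * t\<close> exceeds
  \<open>(r^2 - 1) / 4\<close> by enough to absorb the loss from \<open>N - 2\<close> in place of
  \<open>N\<close>, provided \<open>N\<close> is at least about \<open>r\<close>; the quadratic
  hypothesis supplies this.\<close>

lemma round_robin_parameters:
  fixes r N :: nat
  assumes "r \<ge> 3" and N: "real N \<ge> (real_of_int \<lceil>real r / 2\<rceil> + 1)\<^sup>2 / 2"
  obtains s t where "r = s + t" "odd s" "t > 0"
    "((real r)\<^sup>2 - 1) / 8 * real N \<le> (real (s + 1) * ((real N - 2) / 2) + 1) * real t"
proof -
  define p where "p = r div 2"
  show ?thesis
  proof (cases "even r")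
    case True
    then have r: "r = 2 * p" by (simp add: p_def)
    then have p: "p \<ge> 2" using assms by simp
    have N': "real N \<ge> (real p + 1)\<^sup>2 / 2" using N by (simp add: r)
    \<comment> \<open>AM-GM turns the quadratic hypothesis into the linear bound
      \<open>N \<ge> 2 * p\<close>.\<close>
    have "(real p + 1)\<^sup>2 \<ge> 4 * real p"
      using zero_le_square[of "real p - 1"] by (simp add: power2_eq_square algebra_simps)
    then have "real p * 2 \<le> real N" using N' by linarith
    then have "real p * (real p * 2) \<le> real p * real N" by (intro mult_left_mono) auto
    then have key: "(4 * (real p)\<^sup>2 - 1) / 8 * real N \<le>
        real p * (real p + 1) * ((real N - 2) / 2) + real p"
      by (simp add: power2_eq_square field_simps)
    show ?thesis
    proof (cases "even p")
      case True
      have "r = (p - 1) + (p + 1)" "odd (p - 1)" using True p r by auto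
      then show ?thesis using key p
        by (intro that[of "p - 1" "p + 1"]) (auto simp: r of_nat_diff power_mult_distrib algebra_simps)
    next
      case False
      show ?thesis using key False p
        by (intro that[of p p]) (auto simp: r power_mult_distrib algebra_simps)
    qed
  next
    case False
    then have r: "r = 2 * p + 1" by (simp add: p_def)
    then have p: "p \<ge> 1" using assms by simp
    have "\<lceil>real r / 2\<rceil> = int p + 1" by (simp add: r ceiling_eq_iff)
    then have N': "real N \<ge> (real p + 2)\<^sup>2 / 2" using N by (simp add: add.commute)
    have "(real p + 2)\<^sup>2 \<ge> 4 * (real p + 1)"
      by (simp add: power2_eq_square algebra_simps)
    then have N2: "2 * (real p + 1) \<le> real N" using N' by linarith
    show ?thesis
    proof (cases "even p")
      case True
      have "real p * (2 * (real p + 1)) \<le> real p * real N" using N2 by (intro mult_left_mono) auto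
      then show ?thesis using True p
        by (intro that[of "p + 1" p]) (auto simp: r power2_eq_square field_simps)
    next
      case False
      have "(real p + 1) * (2 * (real p)) \<le> (real p + 1) * real N"
        using N2 by (intro mult_left_mono) auto
      then show ?thesis using False p
        by (intro that[of p "p + 1"]) (auto simp: r power2_eq_square field_simps)
    qed
  qed
qed

theorem theorem1p3:
  fixes r n m :: nat
  assumes "r \<ge> 2"
    and "n \<ge> m"
    and "m \<ge> 1"
    and "real (n + m + 2) \<ge> (real_of_int \<lceil>real r / 2\<rceil> + 1)\<^sup>2 / 2"
  shows "size_ramsey r (double_star n m) \<le> 4 * r\<^sup>2 * n * m + 2 * r * (n + m) + 1
    \<and> (r = 2 \<longrightarrow>
         real (size_ramsey r (double_star n m)) \<ge> 1 / 2 * (real m + 1) * (real n + real m + 2))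
    \<and> (r \<ge> 3 \<longrightarrow>
         real (size_ramsey r (double_star n m))
           \<ge> ((real r)\<^sup>2 - 1) / 16 * real m * (real n + real m + 2))"
proof -
  define Q where "Q k \<longleftrightarrow> (\<exists>G :: nat ugraph. fin_simple_graph G \<and>
    ramsey_graph r G (double_star n m) \<and> card (edges G) = k)" for k
  have size: "size_ramsey r (double_star n m) = (LEAST k. Q k)"
    by (simp add: size_ramsey_def Q_def)
  have QB: "Q ((2 * r * n + 1) * (2 * r * m + 1))"
    unfolding Q_def
    using fin_simple_graph_complete_bipartite card_edges_complete_bipartite
      ramsey_complete_bipartite[of r n m] assms by fastforce
  have upper: "size_ramsey r (double_star n m) \<le> 4 * r\<^sup>2 * n * m + 2 * r * (n + m) + 1"
    using Least_le[of Q, OF QB] by (simp add: size power2_eq_square algebra_simps)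
  \<comment> \<open>The bipartite witness shows that the least value is attained, so the lower
    bounds can be applied to an optimal host graph.\<close>
  obtain G :: "nat ugraph" where G: "fin_simple_graph G" "ramsey_graph r G (double_star n m)"
    "card (edges G) = size_ramsey r (double_star n m)"
    using LeastI[of Q, OF QB] unfolding Q_def[of "Least Q"] size by blast
  have two: "real (size_ramsey r (double_star n m)) \<ge> 1 / 2 * (real m + 1) * (real n + real m + 2)"
    if "r = 2"
  proof -
    have "(m + 1) * (n + m + 2) \<le> 2 * size_ramsey r (double_star n m)"
      using ramsey_two_colors_edges[of G n m] G that assms by simp
    then have "real ((m + 1) * (n + m + 2)) \<le> real (2 * size_ramsey r (double_star n m))"
      by (simp only: of_nat_le_iff)
    then show ?thesis by (simp add: field_simps)
  qed
  have many: "real (size_ramsey r (double_star n m))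
      \<ge> ((real r)\<^sup>2 - 1) / 16 * real m * (real n + real m + 2)" if r3: "r \<ge> 3"
  proof -
    define N where "N = n + m + 2"
    obtain s t where st: "r = s + t" "odd s" "t > 0"
      and num: "((real r)\<^sup>2 - 1) / 8 * real N \<le> (real (s + 1) * ((real N - 2) / 2) + 1) * real t"
      using assms(4) unfolding N_def by (rule round_robin_parameters[OF r3])
    \<comment> \<open>Rounding up makes the block length at least \<open>(n + m) / 2\<close>, which
      is \<open>(N - 2) / 2\<close>.\<close>
    have "n + m \<le> 2 * ((n + m + 1) div 2)" by linarith
    then have "real (n + m) \<le> real (2 * ((n + m + 1) div 2))" by (simp only: of_nat_le_iff)
    then have half: "(real N - 2) / 2 \<le> real ((n + m + 1) div 2)" by (simp add: N_def)
    have "((s + 1) * ((n + m + 1) div 2) + 1) * (t * m) \<le> 2 * size_ramsey r (double_star n m)"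
      using ramsey_edges[OF G(1), of s t n m] G assms st by simp
    then have le: "real (((s + 1) * ((n + m + 1) div 2) + 1) * (t * m)) \<le>
        real (2 * size_ramsey r (double_star n m))"
      by (simp only: of_nat_le_iff)
    have "((real r)\<^sup>2 - 1) / 8 * real N * real m
        \<le> (real (s + 1) * ((real N - 2) / 2) + 1) * real t * real m"
      using num by (intro mult_right_mono) auto
    also have "\<dots> \<le> (real (s + 1) * real ((n + m + 1) div 2) + 1) * real t * real m"
      using half by (intro mult_right_mono add_right_mono mult_left_mono) auto
    also have "\<dots> \<le> 2 * real (size_ramsey r (double_star n m))"
      using le by (simp add: algebra_simps)
    finally show ?thesis by (simp add: N_def field_simps)
  qed
  show ?thesis using upper two many by blast
qed

end
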